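(* Let $\lambda_1,\lambda_2,\ldots$ be independent indeterminates and $\mathbb{Z}[\lambda]=\mathbb{Z}[\lambda_1,\lambda_2,\ldots]$. For $m\geq 0$ let $\mu_m=\sum_\omega\prod_j \lambda_{\omega(j)}$, where $\omega$ ranges over all maps $\omega:\{1,\ldots,m+1\}\to\{0,1,2,\ldots\}$ with $\omega(1)=\omega(m+1)=0$ and $|\omega(i+1)-\omega(i)|=1$ for all $1\leq i\leq m$, and the product is over those $j\in\{1,\ldots,m\}$ with $\omega(j+1)-\omega(j)=-1$ (so $\mu_m=0$ for $m$ odd). Put $s_k=\lambda_1\lambda_2\cdots\lambda_k$, $s_0=1$. Then for every $n\geq0$, over $\mathbb{Z}[\lambda]$: (i) $(\mu_{i+j})_{0\leq i,j\leq n}$ has special Smith normal form $\mathrm{diag}(s_0,s_1,\ldots,s_n)$; (ii) $(\mu_{2i+2j})_{0\leq i,j\leq n}$ has special Smith normal form $\mathrm{diag}(s_0,s_2,s_4,\ldots,s_{2n})$; (iii) $(\mu_{2i+2j+2})_{0\leq i,j\leq n}$ has special Smith normal form $\mathrm{diag}(s_1,s_3,s_5,\ldots,s_{2n+1})$.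
   Context: For an $m\times n$ matrix $A$ over a commutative ring $R$, a matrix $D$ is a special Smith normal form (SSNF) of $A$ over $R$ if there exist $P\in \mathrm{SL}(m,R)$, $Q\in\mathrm{SL}(n,R)$ (determinant $1$) with $PAQ=D$, $D$ is diagonal, and $d_{ii}$ is a multiple in $R$ of $d_{jj}$ whenever $i\geq j$. *)

theory Defs
  imports "HOL-Library.Poly_Mapping" "HOL-Library.FuncSet" "Jordan_Normal_Form.Determinant"
begin

(* A monomial is a finitely supported exponent vector, a polynomial a finitely supported
   family of integer coefficients indexed by monomials; multiplication is the convolution
   product of Poly_Mapping.  The exponent vectors are indexed by {0, 1, 2, ...}, and
   position k - 1 belongs to lambda_k, so that the type is exactly Z[lambda_1, lambda_2, ...]. *)
type_synonym zlam = "(nat \<Rightarrow>\<^sub>0 nat) \<Rightarrow>\<^sub>0 int"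

(* Only meaningful for k >= 1; the junk value lam 0 is never used below. *)
definition lam :: "nat \<Rightarrow> zlam" where
  "lam k = Poly_Mapping.single (Poly_Mapping.single (k - 1) 1) 1"

(* Extensional functions on {1..m+1}, so that each map is counted once. *)
definition dyck_walks :: "nat \<Rightarrow> (nat \<Rightarrow> nat) set" where
  "dyck_walks m =
     {\<omega> \<in> {1..m+1} \<rightarrow>\<^sub>E (UNIV :: nat set).
        \<omega> 1 = 0 \<and> \<omega> (m+1) = 0 \<and>
        (\<forall>i\<in>{1..m}. \<bar>int (\<omega> (i+1)) - int (\<omega> i)\<bar> = 1)}"

definition mu :: "nat \<Rightarrow> zlam" where
  "mu m = (\<Sum>\<omega>\<in>dyck_walks m.
             \<Prod>j\<in>{j\<in>{1..m}. int (\<omega> (j+1)) - int (\<omega> j) = -1}. lam (\<omega> j))"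

definition lam_prod :: "nat \<Rightarrow> zlam" where
  "lam_prod k = (\<Prod>i=1..k. lam i)"

definition SL :: "nat \<Rightarrow> 'a::comm_ring_1 mat set" where
  "SL n = {P \<in> carrier_mat n n. det P = 1}"

definition is_SSNF :: "'a::comm_ring_1 mat \<Rightarrow> 'a mat \<Rightarrow> bool" where
  "is_SSNF A D \<longleftrightarrow>
     (\<exists>P\<in>SL (dim_row A). \<exists>Q\<in>SL (dim_col A). P * A * Q = D) \<and>
     diagonal_mat D \<and>
     (\<forall>i < min (dim_row D) (dim_col D). \<forall>j \<le> i. D $$ (j, j) dvd D $$ (i, i))"

(* The sum defining mu is finite, so it does not collapse to the default value 0. *)
lemma finite_dyck_walks: "finite (dyck_walks m)"
proof (rule finite_subset)
  show "dyck_walks m \<subseteq> {1..m+1} \<rightarrow>\<^sub>E {..m+1}"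
  proof
    fix \<omega> assume w: "\<omega> \<in> dyck_walks m"
    have ext: "\<omega> \<in> extensional {1..m+1}" and start: "\<omega> 1 = 0"
      and step: "\<forall>i\<in>{1..m}. \<bar>int (\<omega> (i+1)) - int (\<omega> i)\<bar> = 1"
      using w unfolding dyck_walks_def PiE_def by blast+
    have le: "i \<le> m \<longrightarrow> \<omega> (i + 1) \<le> i" for i
    proof (induction i)
      case 0
      then show ?case using start by simp
    next
      case (Suc i)
      show ?case
      proof
        assume "Suc i \<le> m"
        then have "\<bar>int (\<omega> (i + 1 + 1)) - int (\<omega> (i + 1))\<bar> = 1" and "\<omega> (i + 1) \<le> i"
          using step[THEN bspec, of "i + 1"] Suc.IH by simp_all
        then have "\<omega> (i + 1 + 1) \<le> Suc i" by linarith
        then show "\<omega> (Suc i + 1) \<le> Suc i" by simp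
      qed
    qed
    have "\<omega> i \<in> {..m+1}" if "i \<in> {1..m+1}" for i
    proof -
      have "i - 1 \<le> m" and "i - 1 + 1 = i" using that unfolding atLeastAtMost_iff by linarith+
      then show ?thesis using le[of "i - 1"] by (metis atMost_iff le_trans trans_le_add1)
    qed
    then show "\<omega> \<in> {1..m+1} \<rightarrow>\<^sub>E {..m+1}"
      using ext unfolding PiE_def Pi_def by blast
  qed
  show "finite ({1..m+1} \<rightarrow>\<^sub>E {..m+1})"
    by (rule finite_PiE) simp_all
qed

end

(* Let T m k be the weighted number of walks of length m from height 0 to height k.  A walk of
   length i + j from 0 to 0 splits at time i; reversing a walk from k down to 0 turns it into
   a walk from 0 up to k and divides its weight by s_k.  Hence mu (i + j) = sum_k T i k s_k T j k,
   that is, the Hankel matrix is L D L^T with L = (T i k) lower unitriangular.  As T m k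
   vanishes when m + k is odd, the same factorization restricted to even (odd) lengths and
   heights handles the other two matrices. *)

theory Submission
  imports Defs
begin

section \<open>Special Smith forms from unitriangular factorizations\<close>

text \<open>With M the matrix of \<open>L\<close> and D the diagonal matrix of \<open>d\<close>, the
  hypothesis reads A = M D M^T. As M is unitriangular, its inverse P and the transpose of P have
  determinant 1, and P A P^T = D.\<close>

lemma is_SSNF_of_unitriangular_factorization:
  fixes A :: "nat \<Rightarrow> nat \<Rightarrow> 'a::comm_ring_1" and L :: "nat \<Rightarrow> nat \<Rightarrow> 'a"
  assumes A: "\<And>i j. i < n \<Longrightarrow> j < n \<Longrightarrow> A i j = (\<Sum>k<n. L i k * d k * L j k)"
    and lower: "\<And>i k. i < k \<Longrightarrow> L i k = 0"
    and unit: "\<And>i. L i i = 1"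
    and dvd: "\<And>i j. j \<le> i \<Longrightarrow> d j dvd d i"
  shows "is_SSNF (Matrix.mat n n (\<lambda>(i,j). A i j)) (mat_diag n d)"
proof -
  define M where "M = Matrix.mat n n (\<lambda>(i,k). L i k)"
  define D where "D = mat_diag n d"
  \<comment> \<open>The adjugate inverts M because \<open>det M = 1\<close>; this needs no division
    in the ring.\<close>
  define P where "P = adj_mat M"
  have M: "M \<in> carrier_mat n n" and D: "D \<in> carrier_mat n n"
    by (simp_all add: M_def D_def)
  have "det M = prod_list (diag_mat M)"
    by (rule det_lower_triangular[OF _ M]) (simp add: M_def lower)
  also have "diag_mat M = map (\<lambda>_. 1) [0..<n]"
    by (simp add: diag_mat_def M_def unit)
  finally have det_M: "det M = 1"
    by (simp add: map_replicate_const)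
  have P: "P \<in> carrier_mat n n" and PM: "P * M = 1\<^sub>m n"
    using adj_mat[OF M] det_M by (auto simp: P_def)
  have "det P * det M = 1"
    using det_mult[OF P M] PM by simp
  then have det_P: "det P = 1"
    using det_M by simp
  have MP: "M\<^sup>T * P\<^sup>T = 1\<^sub>m n"
    using transpose_mult[OF P M] PM by simp
  have MD: "M * D = Matrix.mat n n (\<lambda>(i,k). L i k * d k)"
    unfolding D_def mat_diag_mult_right[OF M] by (rule eq_matI) (auto simp: M_def)
  have fact: "Matrix.mat n n (\<lambda>(i,j). A i j) = M * D * M\<^sup>T"
    unfolding MD by (rule eq_matI) (auto simp: A M_def scalar_prod_def atLeast0LessThan)
  have "P * (M * D * M\<^sup>T) * P\<^sup>T = (P * M) * D * (M\<^sup>T * P\<^sup>T)"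
    using P M D by (simp add: assoc_mult_mat[of _ n n _ n _ n])
  also have "\<dots> = D"
    using D by (simp add: PM MP)
  finally have "P * Matrix.mat n n (\<lambda>(i,j). A i j) * P\<^sup>T = mat_diag n d"
    by (simp add: fact D_def)
  moreover have "P \<in> SL n" "P\<^sup>T \<in> SL n"
    using P det_P det_transpose[OF P] by (auto simp: SL_def)
  moreover have "diagonal_mat (mat_diag n d)"
    by (simp add: diagonal_mat_def mat_diag_def)
  ultimately show ?thesis
    unfolding is_SSNF_def using dvd by (auto simp: mat_diag_def)
qed

section \<open>Weighted walk counts by recursion on the last step\<close>

text \<open>This is T m k. The last step either rises from k - 1 with weight 1 or falls from k + 1
  with weight \<open>lam (Suc k)\<close>; nothing rises to height 0.\<close>

fun walk_weight :: "nat \<Rightarrow> nat \<Rightarrow> zlam" where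
  "walk_weight 0 k = (if k = 0 then 1 else 0)"
| "walk_weight (Suc m) k =
     (if k = 0 then 0 else walk_weight m (k - 1)) + lam (Suc k) * walk_weight m (Suc k)"

lemma walk_weight_above: "m < k \<Longrightarrow> walk_weight m k = 0"
  by (induction m arbitrary: k) auto

lemma walk_weight_diag: "walk_weight m m = 1"
  by (induction m) (auto simp: walk_weight_above)

text \<open>Each step changes the parity of the height.\<close>

lemma walk_weight_odd: "odd (m + k) \<Longrightarrow> walk_weight m k = 0"
  by (induction m arbitrary: k) (auto simp: odd_pos)

section \<open>The recursion counts the actual walks\<close>

text \<open>The final height is left free because deleting the last step of a closed walk leaves one
  that ends elsewhere.\<close>

definition walks_to :: "nat \<Rightarrow> nat \<Rightarrow> (nat \<Rightarrow> nat) set" where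
  "walks_to m k =
     {\<omega> \<in> {1..m+1} \<rightarrow>\<^sub>E (UNIV :: nat set).
        \<omega> 1 = 0 \<and> \<omega> (m+1) = k \<and>
        (\<forall>i\<in>{1..m}. \<bar>int (\<omega> (i+1)) - int (\<omega> i)\<bar> = 1)}"

text \<open>Rising steps get weight 1, so the product runs over all steps and its last factor can be
  split off.\<close>

definition step_weight :: "(nat \<Rightarrow> nat) \<Rightarrow> nat \<Rightarrow> zlam" where
  "step_weight \<omega> j = (if int (\<omega> (j+1)) - int (\<omega> j) = -1 then lam (\<omega> j) else 1)"

lemma walks_to_0: "walks_to 0 k = (if k = 0 then {\<lambda>i\<in>{1}. 0} else {})"
  by (auto simp: walks_to_def PiE_def extensional_def fun_eq_iff)

text \<open>Deleting the last step is inverse to \<open>extend_walks_to\<close>; the last point of a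
  walk of length \<open>Suc m\<close> has index m + 2.\<close>

lemma restrict_walks_to:
  assumes "\<omega> \<in> walks_to (Suc m) k"
  shows "restrict \<omega> {1..m+1} \<in> walks_to m (\<omega> (m+1))"
    and "\<bar>int k - int (\<omega> (m+1))\<bar> = 1"
    and "(restrict \<omega> {1..m+1})(m+2 := k) = \<omega>"
proof -
  have end_k: "\<omega> (m+2) = k" and ext: "\<And>i. i \<notin> {1..m+2} \<Longrightarrow> \<omega> i = undefined"
    using assms by (auto simp: walks_to_def PiE_def extensional_def)
  have "\<bar>int (\<omega> (m+1+1)) - int (\<omega> (m+1))\<bar> = 1"
    using assms unfolding walks_to_def by force
  then show "\<bar>int k - int (\<omega> (m+1))\<bar> = 1"
    using end_k by simp
  show "restrict \<omega> {1..m+1} \<in> walks_to m (\<omega> (m+1))"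
    using assms by (auto simp: walks_to_def)
  show "(restrict \<omega> {1..m+1})(m+2 := k) = \<omega>"
    using end_k ext by (fastforce simp: fun_eq_iff)
qed

lemma extend_walks_to:
  assumes "\<omega> \<in> walks_to m l" and "\<bar>int k - int l\<bar> = 1"
  shows "\<omega>(m+2 := k) \<in> walks_to (Suc m) k"
    and "restrict (\<omega>(m+2 := k)) {1..m+1} = \<omega>"
proof -
  show "\<omega>(m+2 := k) \<in> walks_to (Suc m) k"
    using assms by (auto simp: walks_to_def PiE_def extensional_def le_Suc_eq)
  have "\<And>i. i \<notin> {1..m+1} \<Longrightarrow> \<omega> i = undefined"
    using assms by (auto simp: walks_to_def PiE_def extensional_def)
  then show "restrict (\<omega>(m+2 := k)) {1..m+1} = \<omega>"
    by (fastforce simp: fun_eq_iff)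
qed

lemma finite_walks_to: "finite (walks_to m k)"
proof (induction m arbitrary: k)
  case 0
  then show ?case by (simp add: walks_to_0)
next
  case (Suc m)
  have "walks_to (Suc m) k \<subseteq> (\<lambda>\<omega>. \<omega>(m+2 := k)) ` (\<Union>l\<le>Suc k. walks_to m l)"
  proof
    fix \<omega> assume w: "\<omega> \<in> walks_to (Suc m) k"
    then have "\<omega> (m+1) \<le> Suc k"
      using restrict_walks_to(2)[OF w] by linarith
    then show "\<omega> \<in> (\<lambda>\<omega>. \<omega>(m+2 := k)) ` (\<Union>l\<le>Suc k. walks_to m l)"
      using restrict_walks_to(1,3)[OF w] by (metis UN_I atMost_iff imageI)
  qed
  then show ?case
    using Suc.IH by (meson finite_UN_I finite_atMost finite_imageI finite_subset)
qed

text \<open>Walks are sorted by the height l before the last step, whose weight becomes a separate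
  factor.\<close>

lemma sum_walks_to_Suc:
  "(\<Sum>\<omega>\<in>walks_to (Suc m) k. \<Prod>j=1..Suc m. step_weight \<omega> j) =
   (\<Sum>l | \<bar>int k - int l\<bar> = 1. \<Sum>\<omega>\<in>walks_to m l.
      (\<Prod>j=1..m. step_weight \<omega> j) * (if int k - int l = -1 then lam l else 1))"
proof -
  have "finite {l. \<bar>int k - int l\<bar> = 1}"
    by (rule finite_subset[of _ "{..Suc k}"]) auto
  then have "(\<Sum>l | \<bar>int k - int l\<bar> = 1. \<Sum>\<omega>\<in>walks_to m l.
      (\<Prod>j=1..m. step_weight \<omega> j) * (if int k - int l = -1 then lam l else 1)) =
    (\<Sum>(l, \<omega>)\<in>Sigma {l. \<bar>int k - int l\<bar> = 1} (walks_to m).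
      (\<Prod>j=1..m. step_weight \<omega> j) * (if int k - int l = -1 then lam l else 1))"
    using finite_walks_to by (subst sum.Sigma) auto
  also have "\<dots> = (\<Sum>\<omega>\<in>walks_to (Suc m) k. \<Prod>j=1..Suc m. step_weight \<omega> j)"
  proof (rule sum.reindex_bij_witness[where
        i = "\<lambda>\<omega>. (\<omega> (m+1), restrict \<omega> {1..m+1})" and j = "\<lambda>(l, \<omega>). \<omega>(m+2 := k)"])
    fix \<omega> assume w: "\<omega> \<in> walks_to (Suc m) k"
    show "(\<omega> (m+1), restrict \<omega> {1..m+1}) \<in> Sigma {l. \<bar>int k - int l\<bar> = 1} (walks_to m)"
      using restrict_walks_to(1,2)[OF w] by simp
    show "(case (\<omega> (m+1), restrict \<omega> {1..m+1}) of (l, \<omega>) \<Rightarrow> \<omega>(m+2 := k)) = \<omega>"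
      using restrict_walks_to(3)[OF w] by simp
  next
    fix a assume a: "a \<in> Sigma {l. \<bar>int k - int l\<bar> = 1} (walks_to m)"
    obtain l \<omega> where a_eq: "a = (l, \<omega>)" by (cases a)
    with a have w: "\<omega> \<in> walks_to m l" and l: "\<bar>int k - int l\<bar> = 1" by auto
    have end_l: "\<omega> (Suc m) = l" using w by (simp add: walks_to_def)
    show "(case a of (l, \<omega>) \<Rightarrow> \<omega>(m+2 := k)) \<in> walks_to (Suc m) k"
      using extend_walks_to(1)[OF w l] a_eq by simp
    show "((case a of (l, \<omega>) \<Rightarrow> \<omega>(m+2 := k)) (m+1),
            restrict (case a of (l, \<omega>) \<Rightarrow> \<omega>(m+2 := k)) {1..m+1}) = a"
      using extend_walks_to(2)[OF w l] a_eq end_l by simp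
    \<comment> \<open>The first m step weights only read points up to m + 1.\<close>
    have "(\<Prod>j=1..m. step_weight (\<omega>(m+2 := k)) j) = (\<Prod>j=1..m. step_weight \<omega> j)"
      by (rule prod.cong) (auto simp: step_weight_def)
    moreover have "step_weight (\<omega>(m+2 := k)) (Suc m) = (if int k - int l = -1 then lam l else 1)"
      by (simp add: step_weight_def end_l)
    ultimately show "(\<Prod>j=1..Suc m. step_weight (case a of (l, \<omega>) \<Rightarrow> \<omega>(m+2 := k)) j) =
        (case a of (l, \<omega>) \<Rightarrow> (\<Prod>j=1..m. step_weight \<omega> j) *
           (if int k - int l = -1 then lam l else 1))"
      by (simp add: a_eq)
  qed
  finally show ?thesis ..
qed

lemma sum_walks_to: "(\<Sum>\<omega>\<in>walks_to m k. \<Prod>j=1..m. step_weight \<omega> j) = walk_weight m k"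
proof (induction m arbitrary: k)
  case 0
  then show ?case by (simp add: walks_to_0)
next
  case (Suc m)
  have "{l. \<bar>int k - int l\<bar> = 1} = (if k = 0 then {Suc k} else {k - 1, Suc k})"
    by auto
  then show ?case
    unfolding sum_walks_to_Suc sum_distrib_right[symmetric] Suc.IH
    by (cases k) (auto simp: mult.commute)
qed

lemma mu_eq_walk_weight: "mu m = walk_weight m 0"
proof -
  have "(\<Prod>j\<in>{j\<in>{1..m}. int (\<omega> (j+1)) - int (\<omega> j) = -1}. lam (\<omega> j)) =
        (\<Prod>j=1..m. step_weight \<omega> j)" for \<omega>
    unfolding step_weight_def by (rule prod.inter_filter) simp
  moreover have "dyck_walks m = walks_to m 0"
    by (simp add: dyck_walks_def walks_to_def)
  ultimately show ?thesis
    unfolding mu_def using sum_walks_to[of m 0] by simp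
qed

section \<open>The convolution identity and the factorization of the Hankel matrix\<close>

lemma lam_prod_0 [simp]: "lam_prod 0 = 1"
  by (simp add: lam_prod_def)

lemma lam_prod_Suc: "lam_prod (Suc k) = lam_prod k * lam (Suc k)"
  by (simp add: lam_prod_def)

lemma lam_prod_dvd: "j \<le> i \<Longrightarrow> lam_prod j dvd lam_prod i"
  unfolding lam_prod_def by (rule prod_dvd_prod_subset) auto

(* The right-hand side is symmetric in i and j, so a step may be moved from one factor
   to the other. *)
lemma walk_weight_convolution_Suc:
  assumes "i \<le> N"
  shows "(\<Sum>k\<le>N. walk_weight (Suc i) k * lam_prod k * walk_weight j k) =
    (\<Sum>k<N. lam_prod (Suc k) *
       (walk_weight i k * walk_weight j (Suc k) + walk_weight i (Suc k) * walk_weight j k))"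
proof -
  have "(\<Sum>k\<le>N. walk_weight (Suc i) k * lam_prod k * walk_weight j k) =
    (\<Sum>k\<le>N. (if k = 0 then 0 else walk_weight i (k - 1)) * lam_prod k * walk_weight j k) +
    (\<Sum>k\<le>N. lam_prod (Suc k) * (walk_weight i (Suc k) * walk_weight j k))"
    unfolding sum.distrib[symmetric]
    by (rule sum.cong) (simp_all add: lam_prod_Suc algebra_simps)
  \<comment> \<open>The term at k = 0 is zero, and the others are shifted by one.\<close>
  also have "(\<Sum>k\<le>N. (if k = 0 then 0 else walk_weight i (k - 1)) * lam_prod k * walk_weight j k)
      = (\<Sum>k<N. lam_prod (Suc k) * (walk_weight i k * walk_weight j (Suc k)))"
    unfolding sum.atMost_shift by (simp add: mult_ac)
  \<comment> \<open>The term at k = N vanishes, since i < N + 1.\<close>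
  also have "(\<Sum>k\<le>N. lam_prod (Suc k) * (walk_weight i (Suc k) * walk_weight j k)) =
      (\<Sum>k<N. lam_prod (Suc k) * (walk_weight i (Suc k) * walk_weight j k))"
    using assms by (simp add: lessThan_Suc_atMost[symmetric] walk_weight_above)
  finally show ?thesis
    by (simp add: sum.distrib distrib_left)
qed

text \<open>Steps move one by one from the second factor to the first, keeping i + j and N fixed.
  Once j = 0, only k = 0 contributes.\<close>

lemma walk_weight_convolution:
  assumes "i + j \<le> N"
  shows "(\<Sum>k\<le>N. walk_weight i k * lam_prod k * walk_weight j k) = walk_weight (i + j) 0"
  using assms
proof (induction j arbitrary: i)
  case 0
  have "(\<Sum>k\<le>N. walk_weight i k * lam_prod k * walk_weight 0 k) =
        (\<Sum>k\<le>N. if k = 0 then walk_weight i 0 else 0)"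
    by (rule sum.cong) auto
  then show ?case by simp
next
  case (Suc j)
  have "(\<Sum>k\<le>N. walk_weight i k * lam_prod k * walk_weight (Suc j) k) =
        (\<Sum>k\<le>N. walk_weight (Suc j) k * lam_prod k * walk_weight i k)"
    by (simp add: mult_ac del: walk_weight.simps)
  also have "\<dots> = (\<Sum>k\<le>N. walk_weight (Suc i) k * lam_prod k * walk_weight j k)"
    using Suc.prems walk_weight_convolution_Suc[of j N i] walk_weight_convolution_Suc[of i N j]
    by (simp add: algebra_simps del: walk_weight.simps)
  also have "\<dots> = walk_weight (i + Suc j) 0"
    using Suc.IH[of "Suc i"] Suc.prems by simp
  finally show ?case .
qed

lemma mu_add:
  assumes "i < n" "j < n"
  shows "mu (i + j) = (\<Sum>k<n. walk_weight i k * lam_prod k * walk_weight j k)"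
proof -
  \<comment> \<open>This bound is large enough for the convolution and covers all k < n; the terms
    with k \<ge> n vanish because i < n.\<close>
  have "mu (i + j) = (\<Sum>k\<le>i+j+n. walk_weight i k * lam_prod k * walk_weight j k)"
    by (simp add: mu_eq_walk_weight walk_weight_convolution)
  also have "\<dots> = (\<Sum>k<n. walk_weight i k * lam_prod k * walk_weight j k)"
    using assms by (intro sum.mono_neutral_right) (auto simp: walk_weight_above)
  finally show ?thesis .
qed

section \<open>Restriction to even and to odd heights\<close>

lemma sum_lessThan_double:
  fixes f :: "nat \<Rightarrow> 'a::comm_monoid_add"
  shows "(\<Sum>k<2*n. f k) = (\<Sum>k<n. f (2*k) + f (2*k+1))"
  by (induction n) (simp_all add: add.assoc)

text \<open>In the factorization of size \<open>2*n\<close>, the odd heights drop out by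
  parity.\<close>

lemma mu_add_even:
  assumes "i < n" "j < n"
  shows "mu (2*i + 2*j) =
    (\<Sum>k<n. walk_weight (2*i) (2*k) * lam_prod (2*k) * walk_weight (2*j) (2*k))"
  using assms by (simp add: mu_add[of _ "2*n"] sum_lessThan_double walk_weight_odd)

lemma mu_add_odd:
  assumes "i < n" "j < n"
  shows "mu (2*i + 2*j + 2) =
    (\<Sum>k<n. walk_weight (2*i+1) (2*k+1) * lam_prod (2*k+1) * walk_weight (2*j+1) (2*k+1))"
proof -
  \<comment> \<open>Each side takes one of the two extra steps, so both lengths are odd and only odd
    heights survive.\<close>
  have "mu (2*i + 2*j + 2) = mu ((2*i+1) + (2*j+1))"
    by (simp add: add_ac)
  also have "\<dots> = (\<Sum>k<2*n. walk_weight (2*i+1) k * lam_prod k * walk_weight (2*j+1) k)"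
    using assms by (intro mu_add) auto
  finally show ?thesis
    by (simp add: sum_lessThan_double walk_weight_odd del: walk_weight.simps)
qed

theorem theorem4p9:
  fixes n :: nat
  shows "is_SSNF (Matrix.mat (n+1) (n+1) (\<lambda>(i,j). mu (i + j)))
                 (mat_diag (n+1) (\<lambda>i. lam_prod i))
       \<and> is_SSNF (Matrix.mat (n+1) (n+1) (\<lambda>(i,j). mu (2*i + 2*j)))
                 (mat_diag (n+1) (\<lambda>i. lam_prod (2*i)))
       \<and> is_SSNF (Matrix.mat (n+1) (n+1) (\<lambda>(i,j). mu (2*i + 2*j + 2)))
                 (mat_diag (n+1) (\<lambda>i. lam_prod (2*i + 1)))"
proof (intro conjI)
  show "is_SSNF (Matrix.mat (n+1) (n+1) (\<lambda>(i,j). mu (i + j)))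
          (mat_diag (n+1) (\<lambda>i. lam_prod i))"
    by (rule is_SSNF_of_unitriangular_factorization[where L = walk_weight])
      (simp_all only: mu_add walk_weight_above walk_weight_diag lam_prod_dvd)
  show "is_SSNF (Matrix.mat (n+1) (n+1) (\<lambda>(i,j). mu (2*i + 2*j)))
          (mat_diag (n+1) (\<lambda>i. lam_prod (2*i)))"
    \<comment> \<open>Keeping the rows and columns of even index preserves lower unitriangularity;
      the last case does so with odd indices.\<close>
    by (rule is_SSNF_of_unitriangular_factorization[where L = "\<lambda>i k. walk_weight (2*i) (2*k)"])
      (simp_all add: mu_add_even walk_weight_above walk_weight_diag lam_prod_dvd
        del: walk_weight.simps sum.lessThan_Suc)
  show "is_SSNF (Matrix.mat (n+1) (n+1) (\<lambda>(i,j). mu (2*i + 2*j + 2)))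
          (mat_diag (n+1) (\<lambda>i. lam_prod (2*i + 1)))"
    by (rule is_SSNF_of_unitriangular_factorization
          [where L = "\<lambda>i k. walk_weight (2*i+1) (2*k+1)"])
      (simp_all only: mu_add_odd walk_weight_above walk_weight_diag lam_prod_dvd
        add_less_cancel_right add_le_cancel_right mult_less_cancel1 mult_le_cancel1 mult_le_mono
        order_refl zero_less_numeral simp_thms)
qed

end
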